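(* Consider i.i.d. observations $(X_1,Y_1),\dots,(X_n,Y_n)$ from $Y=f^*(X)+\xi$, where $f^*:[0,1]^d\to\mathbb{R}$ is continuous. Suppose that $P_X$, the law of $X$, has a density that is bounded below by a constant $C_{P_X}>0$ on $[0,1]^d$. Suppose that the preprocessed output $\hat Y:[0,1]^d\to\mathbb{R}$ (a random map) is continuous, satisfies $\mathbb{E}[\|\hat Y\|_{L^\infty}^2]\le V^2$ for some $V>0$, and satisfies $\mathbb{E}[\|\hat Y-f^*\|_{L^\infty}^2]\le\zeta_n^2$ for all $n\in\mathbb{N}$, with a non-negative sequence $\zeta_n\to0$. Let $\hat f$ be the adversarial estimator $$\hat f\in\operatorname*{argmin}_{f\in\mathcal{F}(L,W)}\frac1n\sum_{i=1}^n\sup_{x'\in\Delta_h^p(X_i)}(\hat Y(x')-f(x'))^2 .$$ Then there exists a tuple $(L,W)$ with $LW=o(n)$ such that $$\mathbb{E}\big[\|\hat f-f^*\|_{L^\infty}^2\big]\to0\qquad(n\to\infty).$$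
   Context: $d\in\mathbb{N}$, $X$ takes values in $[0,1]^d$; the noise $\xi$ has zero mean and finite variance and is independent of $X$. $\|g\|_{L^\infty}=\sup_{x\in[0,1]^d}|g(x)|$. The order $p\ge1$ ($p=\infty$ allowed) and $h\in(\underline h,1)$ (with some $\underline h>0$) are given. $\hat Y$ depends on $n$ and may be constructed from the same data as used for $\hat f$. Neighbourhood: $\Delta_h^p(x)=\{x'\in[0,1]^d:\|x-x'\|_p\le h\}$. Neural networks: for $L\in\mathbb{N}$ and widths $\mathcal{W}=(W_1,\dots,W_{L+1})$ with $W_1=d$, $W_{L+1}=1$, a network is $f_\theta=g_L\circ\cdots\circ g_1$ with $g_\ell(z)=\sigma(A_\ell z+b_\ell)$ for $\ell\le L-1$, $g_L(z)=A_Lz+b_L$, where $\sigma$ is the componentwise ReLU $\sigma(z)_i=\max\{z_i,0\}$, $A_\ell\in\mathbb{R}^{W_{\ell+1}\times W_\ell}$, $b_\ell\in\mathbb{R}^{W_{\ell+1}}$. $\mathcal{F}(L,W)$ is the set of all such functions on $[0,1]^d$ (with arbitrary real parameters) with $\max_\ell W_\ell\le W$ and $\|f_\theta\|_{L^\infty}\le B$, where $B\ge1$ is a given constant. The tuple $(L,W)$ may depend on $n$.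
   Formalization: The formal theorem adds the assumption ‖f*‖_{L∞} ≤ B, where B is the bound on the networks in F(L,W); without it the claim is false (e.g. f* ≡ B+1 with Ŷ = f* keeps the error at least 1). *)

theory Defs
  imports
    "HOL-Probability.Probability"
    "HOL-Library.Landau_Symbols"
    "Jordan_Normal_Form.Matrix"
begin

abbreviation unit_cube :: "(real ^ 'd::finite) set" where
  "unit_cube \<equiv> cbox 0 1"

text \<open>A real-valued supremum: it is the usual norm for functions bounded on the cube, in particular
  for functions continuous there.\<close>

definition supnorm :: "(real ^ 'd::finite \<Rightarrow> real) \<Rightarrow> real" where
  "supnorm g = (SUP x\<in>unit_cube. \<bar>g x\<bar>)"

definition lp_norm :: "ereal \<Rightarrow> real ^ 'd::finite \<Rightarrow> real" where
  "lp_norm p z =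
     (if p = \<infinity> then infnorm z
      else (\<Sum>i\<in>UNIV. \<bar>vec_nth z i\<bar> powr real_of_ereal p) powr (1 / real_of_ereal p))"

definition adv_nbhd :: "ereal \<Rightarrow> real \<Rightarrow> real ^ 'd::finite \<Rightarrow> (real ^ 'd) set" where
  "adv_nbhd p h x = {x' \<in> unit_cube. lp_norm p (x - x') \<le> h}"

definition relu :: "real \<Rightarrow> real" where
  "relu t = max t 0"

primrec hidden_layers ::
  "(nat \<Rightarrow> real mat) \<Rightarrow> (nat \<Rightarrow> real Matrix.vec) \<Rightarrow> nat \<Rightarrow> real Matrix.vec \<Rightarrow> real Matrix.vec" where
  "hidden_layers A b 0 z = z"
| "hidden_layers A b (Suc l) z = map_vec relu (A (Suc l) *\<^sub>v hidden_layers A b l z + b (Suc l))"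

text \<open>Layers are numbered from 1; the last one has no activation.\<close>

definition relu_net ::
  "nat \<Rightarrow> (nat \<Rightarrow> real mat) \<Rightarrow> (nat \<Rightarrow> real Matrix.vec) \<Rightarrow> real Matrix.vec \<Rightarrow> real Matrix.vec" where
  "relu_net L A b z = A L *\<^sub>v hidden_layers A b (L - 1) z + b L"

text \<open>The coordinates of \<^typ>\<open>real ^ 'd\<close> are listed in a fixed order as entries
  \<open>0, \<dots>, CARD('d) - 1\<close> of a vector (\<open>from_nat_into UNIV\<close> is a bijection from
  \<open>{..<CARD('d)}\<close> onto \<^typ>\<open>'d\<close>). The order is immaterial, as permuting inputs permutes
  the columns of the first weight matrix.\<close>

definition input_vec :: "real ^ 'd::finite \<Rightarrow> real Matrix.vec" where
  "input_vec x = Matrix.vec CARD('d) (\<lambda>i. vec_nth x (from_nat_into UNIV i))"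

text \<open>Functions on the cube are represented by total functions whose values off the cube are
  arbitrary. The class is empty unless \<open>L \<ge> 1\<close> and \<open>W \<ge> CARD('d)\<close>.\<close>

definition net_class :: "real \<Rightarrow> nat \<Rightarrow> nat \<Rightarrow> (real ^ 'd::finite \<Rightarrow> real) set" where
  "net_class B L W =
     {f. 1 \<le> L \<and>
         (\<exists>w A b. w 1 = CARD('d) \<and> w (L + 1) = 1 \<and>
            (\<forall>l\<in>{1..L + 1}. 1 \<le> w l \<and> w l \<le> W) \<and>
            (\<forall>l\<in>{1..L}. A l \<in> carrier_mat (w (l + 1)) (w l) \<and> b l \<in> carrier_vec (w (l + 1))) \<and>
            (\<forall>x\<in>unit_cube. f x = vec_index (relu_net L A b (input_vec x)) 0)) \<and>
         supnorm f \<le> B}"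

definition adv_risk ::
  "ereal \<Rightarrow> real \<Rightarrow> nat \<Rightarrow> (nat \<Rightarrow> real ^ 'd::finite) \<Rightarrow> (real ^ 'd \<Rightarrow> real) \<Rightarrow> (real ^ 'd \<Rightarrow> real) \<Rightarrow> real"
  where
  "adv_risk p h n x y f =
     1 / real n * (\<Sum>i<n. SUP x'\<in>adv_nbhd p h (x i). (y x' - f x')\<^sup>2)"

text \<open>\<^const>\<open>prob_space.indep_var\<close> forces both variables to have the same type; this is
  independence of the generated \<open>\<sigma>\<close>-algebras for variables of different types.\<close>

definition indep_rv :: "'w measure \<Rightarrow> 'a measure \<Rightarrow> ('w \<Rightarrow> 'a) \<Rightarrow> 'b measure \<Rightarrow> ('w \<Rightarrow> 'b) \<Rightarrow> bool" where
  "indep_rv M M1 X1 M2 X2 \<longleftrightarrow>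
     X1 \<in> measurable M M1 \<and> X2 \<in> measurable M M2 \<and>
     prob_space.indep_set M
       (sets (vimage_algebra (space M) X1 M1)) (sets (vimage_algebra (space M) X2 M2))"

text \<open>Expectation as a nonnegative integral, so that it is infinite when the squared norm is not
  integrable.\<close>

definition expected_sq_supnorm :: "'w measure \<Rightarrow> ('w \<Rightarrow> real ^ 'd::finite \<Rightarrow> real) \<Rightarrow> ennreal" where
  "expected_sq_supnorm M g = (\<integral>\<^sup>+\<omega>. ennreal ((supnorm (g \<omega>))\<^sup>2) \<partial>M)"

text \<open>A random element of the continuous functions on the cube; its supremum norm is measurable.\<close>

definition random_continuous_map :: "'w measure \<Rightarrow> ('w \<Rightarrow> real ^ 'd::finite \<Rightarrow> real) \<Rightarrow> bool" where
  "random_continuous_map M g \<longleftrightarrow>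
     (\<forall>x\<in>unit_cube. (\<lambda>\<omega>. g \<omega> x) \<in> borel_measurable M) \<and>
     (\<forall>\<omega>\<in>space M. continuous_on unit_cube (g \<omega>))"

text \<open>A measurable selection from the set of minimisers, so that the risk of \<open>fhat\<close> is an honest
  expectation.\<close>

definition adv_estimator ::
  "'w measure \<Rightarrow> real \<Rightarrow> ereal \<Rightarrow> real \<Rightarrow> nat \<Rightarrow> nat \<Rightarrow> nat \<Rightarrow> (nat \<Rightarrow> 'w \<Rightarrow> real ^ 'd::finite) \<Rightarrow>
   ('w \<Rightarrow> real ^ 'd \<Rightarrow> real) \<Rightarrow> ('w \<Rightarrow> real ^ 'd \<Rightarrow> real) \<Rightarrow> bool" where
  "adv_estimator M B p h L W n X Yhat fhat \<longleftrightarrow>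
     (\<forall>x\<in>unit_cube. (\<lambda>\<omega>. fhat \<omega> x) \<in> borel_measurable M) \<and>
     (\<forall>\<omega>\<in>space M.
        is_arg_min (adv_risk p h n (\<lambda>i. X i \<omega>) (Yhat \<omega>)) (\<lambda>f. f \<in> net_class B L W) (fhat \<omega>))"

end

theory Submission
  imports Defs "HOL-Real_Asymp.Real_Asymp"
begin

text \<open>The neighbourhoods have fixed radius, so the adversarial empirical risk controls the supremum
  norm. Cover the cube by finitely many balls of radius \<open>h / (2d)\<close>; any two points of the same ball
  lie in each other's neighbourhood. By Hoeffding's inequality every ball contains a fixed fraction
  of the sample, outside an event whose probability decays exponentially. Off that event
  \<open>(Yhat - fhat)\<^sup>2\<close> is bounded on the whole cube by a constant times the risk of \<open>fhat\<close>, hence of any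
  competitor in the class; on it the error is at most \<open>2 B\<close>. By universal approximation there are
  networks converging uniformly to \<open>fstar\<close>, and running through them slowly enough keeps
  \<open>L W = o(n)\<close>.\<close>

section \<open>Density of ReLU networks\<close>

text \<open>A straight-line program adds one ReLU unit per layer and carries all earlier values along: these
  are nonnegative on the cube, so the activation leaves them unchanged.\<close>

inductive relu_program :: "nat \<Rightarrow> (nat \<Rightarrow> real ^ 'd::finite \<Rightarrow> real) \<Rightarrow> bool" where
  inputs: "relu_program CARD('d) (\<lambda>i x. vec_nth x (from_nat_into UNIV i))"
| unit: "relu_program n g \<Longrightarrow>
    relu_program (Suc n) (g(n := (\<lambda>x. relu (c + (\<Sum>j<n. a j * g j x)))))"

lemma relu_program_nonneg:
  assumes "relu_program n g" "x \<in> unit_cube" "i < n"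
  shows "0 \<le> g i x"
  using assms
proof (induction arbitrary: i)
  case inputs
  then show ?case by (simp add: mem_box_cart)
next
  case (unit n g c a)
  then show ?case by (cases "i = n") (auto simp: relu_def)
qed

lemma relu_program_ge: "relu_program n (g :: nat \<Rightarrow> real ^ 'd::finite \<Rightarrow> real) \<Longrightarrow> CARD('d) \<le> n"
  by (induction rule: relu_program.induct) auto

text \<open>Units are only ever written at positions from \<open>CARD('d)\<close> on, so every
  program still holds the coordinates of its input.\<close>

lemma relu_program_input:
  assumes "relu_program n (g :: nat \<Rightarrow> real ^ 'd::finite \<Rightarrow> real)" "i < CARD('d)"
  shows "g i = (\<lambda>x. vec_nth x (from_nat_into UNIV i))"
  using assms
proof (induction)
  case (unit n g c a)
  then show ?case using relu_program_ge[of n g] by auto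
qed auto

lemma hidden_layers_cong:
  assumes "\<And>k. 1 \<le> k \<Longrightarrow> k \<le> l \<Longrightarrow> A k = A' k \<and> b k = b' k"
  shows "hidden_layers A b l z = hidden_layers A' b' l z"
  using assms by (induction l) auto

text \<open>The last layer of a network has no activation, so these are the functions it can read
  off the stored values. Stored values are nonnegative on the cube; signed functions enter only
  through such combinations.\<close>

definition affine_in :: "nat \<Rightarrow> (nat \<Rightarrow> 'a \<Rightarrow> real) \<Rightarrow> ('a \<Rightarrow> real) \<Rightarrow> bool" where
  "affine_in n g f \<longleftrightarrow> (\<exists>a c. \<forall>x. f x = c + (\<Sum>j<n. a j * g j x))"

definition layer_mats where
  "layer_mats w A b l \<longleftrightarrow> (\<forall>k\<in>{1..l}. A k \<in> carrier_mat (w (k + 1)) (w k) \<and> b k \<in> carrier_vec (w (k + 1)))"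

lemma relu_program_hidden_layers:
  assumes "relu_program n (g :: nat \<Rightarrow> real ^ 'd::finite \<Rightarrow> real)"
  shows "\<exists>l w A b. w 1 = CARD('d) \<and> w (Suc l) = n \<and> (\<forall>k\<in>{1..l + 1}. 1 \<le> w k) \<and>
      layer_mats w A b l \<and>
      (\<forall>x\<in>unit_cube. hidden_layers A b l (input_vec x) = Matrix.vec n (\<lambda>i. g i x))"
  using assms
proof induction
  case inputs
  have "1 \<le> CARD('d)" by (simp add: Suc_le_eq)
  then show ?case
    by (intro exI[of _ 0] exI[of _ "\<lambda>_. CARD('d)"]) (auto simp: input_vec_def layer_mats_def)
next
  case (unit n g c a)
  then obtain l w A b where w: "w 1 = CARD('d)" "w (Suc l) = n" "\<forall>k\<in>{1..l + 1}. 1 \<le> w k"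
    and Ab: "layer_mats w A b l"
    and out: "\<And>x. x \<in> unit_cube \<Longrightarrow> hidden_layers A b l (input_vec x) = Matrix.vec n (\<lambda>i. g i x)"
    by blast
  \<comment> \<open>The rows below \<open>n\<close> are those of the identity, with bias
    \<open>0\<close>, and carry the stored values; row \<open>n\<close> computes the new unit. Only
    layer \<open>Suc l\<close> is overwritten, so the output of the first \<open>l\<close> layers
    stays the same.\<close>
  define A' where "A' = A(Suc l := Matrix.mat (Suc n) n (\<lambda>(i, j). if i = n then a j else if i = j then 1 else 0))"
  define b' where "b' = b(Suc l := Matrix.vec (Suc n) (\<lambda>i. if i = n then c else 0))"
  define w' where "w' = w(Suc (Suc l) := Suc n)"
  define g' where "g' = g(n := (\<lambda>x. relu (c + (\<Sum>j<n. a j * g j x))))"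
  have "hidden_layers A' b' (Suc l) (input_vec x) = Matrix.vec (Suc n) (\<lambda>i. g' i x)"
    if x: "x \<in> unit_cube" for x
  proof -
    have pre: "hidden_layers A' b' l (input_vec x) = Matrix.vec n (\<lambda>i. g i x)"
      using out[OF x] hidden_layers_cong[of l A' A b' b] by (simp add: A'_def b'_def)
    have carry: "relu (\<Sum>j = 0..<n. (if i = j then 1 else 0) * g j x) = g i x" if "i < n" for i
    proof -
      have "(\<Sum>j = 0..<n. (if i = j then 1 else 0) * g j x) = g i x"
        using that by (simp add: if_distrib[of "\<lambda>u. u * _"] cong: if_cong)
      then show ?thesis using relu_program_nonneg[OF unit.hyps x that] by (simp add: relu_def)
    qed
    have layer: "A' (Suc l) = Matrix.mat (Suc n) n (\<lambda>(i, j). if i = n then a j else if i = j then 1 else 0)"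
      "b' (Suc l) = Matrix.vec (Suc n) (\<lambda>i. if i = n then c else 0)"
      by (simp_all add: A'_def b'_def)
    show ?thesis
    proof (rule eq_vecI)
      fix i assume "i < dim_vec (Matrix.vec (Suc n) (\<lambda>i. g' i x))"
      then have i: "i < Suc n" by simp
      show "vec_index (hidden_layers A' b' (Suc l) (input_vec x)) i = vec_index (Matrix.vec (Suc n) (\<lambda>i. g' i x)) i"
        using i carry[of i]
        by (auto simp: pre layer g'_def scalar_prod_def lessThan_atLeast0 add.commute)
    qed (simp add: pre layer)
  qed
  moreover have "layer_mats w' A' b' (Suc l)"
    using Ab w(2) by (auto simp: layer_mats_def w'_def A'_def b'_def)
  moreover have "w' 1 = CARD('d)" "w' (Suc (Suc l)) = Suc n" "\<forall>k\<in>{1..Suc l + 1}. 1 \<le> w' k"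
    using w by (auto simp: w'_def)
  ultimately show ?case unfolding g'_def by blast
qed

lemma relu_program_net_class:
  assumes "relu_program n (g :: nat \<Rightarrow> real ^ 'd::finite \<Rightarrow> real)" "affine_in n g f" "supnorm f \<le> B"
  shows "\<exists>L W. CARD('d) \<le> W \<and> 1 \<le> L \<and> f \<in> net_class B L W"
proof -
  obtain l w A b where w: "w 1 = CARD('d)" "w (Suc l) = n" "\<forall>k\<in>{1..l + 1}. 1 \<le> w k"
    and Ab: "layer_mats w A b l"
    and out: "\<And>x. x \<in> unit_cube \<Longrightarrow> hidden_layers A b l (input_vec x) = Matrix.vec n (\<lambda>i. g i x)"
    using relu_program_hidden_layers[OF assms(1)] by blast
  obtain a c where f: "\<And>x. f x = c + (\<Sum>j<n. a j * g j x)"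
    using assms(2) unfolding affine_in_def by blast
  define A' where "A' = A(Suc l := Matrix.mat 1 n (\<lambda>(i, j). a j))"
  define b' where "b' = b(Suc l := Matrix.vec 1 (\<lambda>i. c))"
  define w' where "w' = w(Suc (Suc l) := 1)"
  \<comment> \<open>The input layer is included in the maximum, which yields
    \<open>CARD('d) \<le> W\<close> at the end.\<close>
  define W where "W = Max (w' ` {1..Suc l + 1})"
  have W: "w' k \<le> W" if "k \<in> {1..Suc l + 1}" for k
    unfolding W_def by (rule Max_ge) (use that in auto)
  have "f x = vec_index (relu_net (Suc l) A' b' (input_vec x)) 0" if x: "x \<in> unit_cube" for x
  proof -
    have "hidden_layers A' b' l (input_vec x) = Matrix.vec n (\<lambda>i. g i x)"
      using out[OF x] hidden_layers_cong[of l A' A b' b] by (simp add: A'_def b'_def)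
    then show ?thesis
      by (simp add: relu_net_def A'_def b'_def scalar_prod_def f lessThan_atLeast0)
  qed
  moreover have "layer_mats w' A' b' (Suc l)"
    using Ab w(2) by (auto simp: layer_mats_def w'_def A'_def b'_def)
  moreover have w': "w' 1 = CARD('d)" "w' (Suc l + 1) = 1" "\<forall>k\<in>{1..Suc l + 1}. 1 \<le> w' k"
    using w by (auto simp: w'_def)
  ultimately have "f \<in> net_class B (Suc l) W"
    using W assms(3) unfolding net_class_def layer_mats_def
    by (intro CollectI conjI exI[of _ w'] exI[of _ A'] exI[of _ b']) auto
  moreover have "CARD('d) \<le> W" using W[of 1] w' by simp
  ultimately show ?thesis by (metis le_add1 plus_1_eq_Suc)
qed

text \<open>Quantifying over all starting programs makes the computable functions closed under
  combination: the second argument is computed by extending a program that already holds the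
  first.\<close>

definition relu_computable :: "(real ^ 'd::finite \<Rightarrow> real) \<Rightarrow> bool" where
  "relu_computable f \<longleftrightarrow> (\<forall>n g. relu_program n g \<longrightarrow>
     (\<exists>n' g'. relu_program n' g' \<and> n \<le> n' \<and> (\<forall>i<n. g' i = g i) \<and> affine_in n' g' f))"

section \<open>Closure properties of the computable functions\<close>

lemma affine_in_extend:
  assumes "affine_in n g f" "n \<le> n'" "\<forall>i<n. g' i = g i"
  shows "affine_in n' g' f"
proof -
  obtain a c where f: "\<And>x. f x = c + (\<Sum>j<n. a j * g j x)"
    using assms(1) unfolding affine_in_def by blast
  have "(\<Sum>j<n'. (if j < n then a j else 0) * g' j x) = (\<Sum>j<n. a j * g j x)" for x
    using assms(2,3) by (intro sum.mono_neutral_cong_right) auto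
  then show ?thesis
    unfolding affine_in_def by (intro exI[of _ "\<lambda>j. if j < n then a j else 0"] exI[of _ c]) (simp add: f)
qed

lemma affine_in_const: "affine_in n g (\<lambda>x. c)"
  unfolding affine_in_def by (intro exI[of _ "\<lambda>_. 0"] exI[of _ c]) simp

lemma affine_in_component: "i < n \<Longrightarrow> affine_in n g (g i)"
  unfolding affine_in_def
  by (intro exI[of _ "\<lambda>j. if j = i then 1 else 0"] exI[of _ 0])
     (simp add: if_distrib[of "\<lambda>u. u * _"] cong: if_cong)

lemma affine_in_lincomb:
  assumes "affine_in n g f1" "affine_in n g f2"
  shows "affine_in n g (\<lambda>x. r * f1 x + s * f2 x)"
proof -
  obtain a c where f1: "\<And>x. f1 x = c + (\<Sum>j<n. a j * g j x)"
    using assms(1) unfolding affine_in_def by blast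
  obtain a' c' where f2: "\<And>x. f2 x = c' + (\<Sum>j<n. a' j * g j x)"
    using assms(2) unfolding affine_in_def by blast
  show ?thesis
    unfolding affine_in_def
    by (intro exI[of _ "\<lambda>j. r * a j + s * a' j"] exI[of _ "r * c + s * c'"])
       (simp add: f1 f2 sum_distrib_left algebra_simps sum.distrib)
qed

lemma relu_computable_const: "relu_computable (\<lambda>x. c)"
  unfolding relu_computable_def using affine_in_const by blast

lemma relu_computable_component: "relu_computable (\<lambda>x :: real ^ 'd::finite. vec_nth x i)"
proof -
  have "i \<in> from_nat_into UNIV ` {..<CARD('d)}"
    using bij_betw_from_nat_into_finite[of "UNIV :: 'd set"] by (simp add: bij_betw_def)
  then obtain k where k: "k < CARD('d)" "from_nat_into UNIV k = i" by auto
  show ?thesis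
    unfolding relu_computable_def
  proof (intro allI impI)
    fix n g assume g: "relu_program n (g :: nat \<Rightarrow> real ^ 'd \<Rightarrow> real)"
    have "affine_in n g (g k)" using relu_program_ge[OF g] k(1) by (intro affine_in_component) simp
    then show "\<exists>n' g'. relu_program n' g' \<and> n \<le> n' \<and> (\<forall>i<n. g' i = g i) \<and> affine_in n' g' (\<lambda>x. vec_nth x i)"
      using g relu_program_input[OF g k(1)] k(2) by auto
  qed
qed

lemma relu_computable_lincomb:
  assumes "relu_computable f1" "relu_computable f2"
  shows "relu_computable (\<lambda>x. r * f1 x + s * f2 x)"
  unfolding relu_computable_def
proof (intro allI impI)
  fix n g assume "relu_program n (g :: nat \<Rightarrow> real ^ 'a \<Rightarrow> real)"
  then obtain n1 g1 where 1: "relu_program n1 g1" "n \<le> n1" "\<forall>i<n. g1 i = g i" "affine_in n1 g1 f1"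
    using assms(1) unfolding relu_computable_def by metis
  then obtain n2 g2 where 2: "relu_program n2 g2" "n1 \<le> n2" "\<forall>i<n1. g2 i = g1 i" "affine_in n2 g2 f2"
    using assms(2) unfolding relu_computable_def by metis
  \<comment> \<open>The second extension keeps all values of the first, so \<open>f1\<close> can
    still be read off.\<close>
  have "affine_in n2 g2 f1" using affine_in_extend[OF 1(4) 2(2,3)] .
  then show "\<exists>n' g'. relu_program n' g' \<and> n \<le> n' \<and> (\<forall>i<n. g' i = g i) \<and> affine_in n' g' (\<lambda>x. r * f1 x + s * f2 x)"
    using 1 2 affine_in_lincomb by (intro exI[of _ n2] exI[of _ g2]) auto
qed

lemma relu_computable_relu:
  assumes "relu_computable f"
  shows "relu_computable (\<lambda>x. relu (f x))"
  unfolding relu_computable_def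
proof (intro allI impI)
  fix n g assume "relu_program n (g :: nat \<Rightarrow> real ^ 'a \<Rightarrow> real)"
  then obtain n1 g1 where 1: "relu_program n1 g1" "n \<le> n1" "\<forall>i<n. g1 i = g i" "affine_in n1 g1 f"
    using assms unfolding relu_computable_def by metis
  then obtain a c where f: "\<And>x. f x = c + (\<Sum>j<n1. a j * g1 j x)"
    unfolding affine_in_def by blast
  define g2 where "g2 = g1(n1 := (\<lambda>x. relu (c + (\<Sum>j<n1. a j * g1 j x))))"
  have "relu_program (Suc n1) g2" unfolding g2_def by (rule relu_program.unit[OF 1(1)])
  moreover have "affine_in (Suc n1) g2 (\<lambda>x. relu (f x))"
    using affine_in_component[of n1 "Suc n1" g2] by (simp add: g2_def f)
  ultimately show "\<exists>n' g'. relu_program n' g' \<and> n \<le> n' \<and> (\<forall>i<n. g' i = g i) \<and> affine_in n' g' (\<lambda>x. relu (f x))"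
    using 1 by (intro exI[of _ "Suc n1"] exI[of _ g2]) (auto simp: g2_def)
qed

lemma relu_computable_abs:
  assumes "relu_computable f"
  shows "relu_computable (\<lambda>x. \<bar>f x\<bar>)"
proof -
  \<comment> \<open>This is |t| = relu t + relu (-t). The factors \<open>1\<close> and the summand
    \<open>0 * f x\<close> only give the terms the shape of
    \<open>relu_computable_lincomb\<close>.\<close>
  have "relu_computable (\<lambda>x. 1 * relu (f x) + 1 * relu ((-1) * f x + 0 * f x))"
    by (intro relu_computable_lincomb relu_computable_relu assms)
  also have "(\<lambda>x. 1 * relu (f x) + 1 * relu ((-1) * f x + 0 * f x)) = (\<lambda>x. \<bar>f x\<bar>)"
    by (auto simp: relu_def fun_eq_iff)
  finally show ?thesis .
qed

text \<open>A minimum costs one unit: min a b = a - relu (a - b).\<close>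

lemma relu_computable_min:
  assumes "relu_computable f1" "relu_computable f2"
  shows "relu_computable (\<lambda>x. min (f1 x) (f2 x))"
proof -
  have "relu_computable (\<lambda>x. 1 * f1 x + (-1) * relu (1 * f1 x + (-1) * f2 x))"
    by (intro relu_computable_lincomb relu_computable_relu assms)
  also have "(\<lambda>x. 1 * f1 x + (-1) * relu (1 * f1 x + (-1) * f2 x)) = (\<lambda>x. min (f1 x) (f2 x))"
    by (auto simp: relu_def fun_eq_iff)
  finally show ?thesis .
qed

lemma relu_computable_sum:
  assumes "finite I" "\<And>i. i \<in> I \<Longrightarrow> relu_computable (F i)"
  shows "relu_computable (\<lambda>x. \<Sum>i\<in>I. F i x)"
  using assms
proof (induction rule: finite_induct)
  case (insert i I)
  then have "relu_computable (\<lambda>x. 1 * F i x + 1 * (\<Sum>i\<in>I. F i x))"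
    by (intro relu_computable_lincomb) auto
  then show ?case using insert by simp
qed (simp add: relu_computable_const)

lemma relu_computable_Min:
  assumes "finite T" "T \<noteq> {}" "\<And>y. y \<in> T \<Longrightarrow> relu_computable (F y)"
  shows "relu_computable (\<lambda>x. Min ((\<lambda>y. F y x) ` T))"
  using assms
proof (induction rule: finite_ne_induct)
  case (insert y T)
  then show ?case using relu_computable_min[of "F y" "\<lambda>x. Min ((\<lambda>y. F y x) ` T)"] by simp
qed simp

text \<open>A cone with vertex \<open>y\<close>, height \<open>c\<close> and slope \<open>K\<close>.
  The approximants of a continuous function will be minima of finitely many such cones.\<close>

lemma relu_computable_l1_dist:
  "relu_computable (\<lambda>x :: real ^ 'd::finite. c + K * (\<Sum>i\<in>UNIV. \<bar>vec_nth x i - vec_nth y i\<bar>))"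
proof -
  have "relu_computable (\<lambda>x :: real ^ 'd. 1 * vec_nth x i + (-1) * vec_nth y i)" for i
    by (intro relu_computable_lincomb relu_computable_component relu_computable_const)
  then have "relu_computable (\<lambda>x :: real ^ 'd. \<bar>vec_nth x i - vec_nth y i\<bar>)" for i
    using relu_computable_abs by force
  then have "relu_computable (\<lambda>x :: real ^ 'd. 1 * c + K * (\<Sum>i\<in>UNIV. \<bar>vec_nth x i - vec_nth y i\<bar>))"
    by (intro relu_computable_lincomb relu_computable_const relu_computable_sum) auto
  then show ?thesis by simp
qed

text \<open>The approximant is the inf-convolution of \<open>f\<close> with a steep multiple of the
  \<open>\<ell>\<^sub>1\<close>-distance, with the infimum restricted to a finite net.\<close>

lemma relu_computable_dense:
  fixes f :: "real ^ 'd::finite \<Rightarrow> real"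
  assumes cont: "continuous_on S f" and "compact S" "S \<noteq> {}" and "0 < \<epsilon>"
  shows "\<exists>g. relu_computable g \<and> (\<forall>x\<in>S. \<bar>g x - f x\<bar> \<le> \<epsilon>)"
proof -
  define D where "D x y = (\<Sum>i\<in>UNIV. \<bar>vec_nth x i - vec_nth y i\<bar>)" for x y :: "real ^ 'd"
  have D1: "dist x y \<le> D x y" for x y
    unfolding dist_norm D_def using norm_le_l1_cart[of "x - y"] by simp
  have D2: "D x y \<le> CARD('d) * dist x y" for x y
    unfolding dist_norm D_def using component_le_norm_cart[of "x - y"]
      sum_bounded_above[of UNIV "\<lambda>i. \<bar>vec_nth x i - vec_nth y i\<bar>" "norm (x - y)"] by simp
  obtain \<delta> where \<delta>: "0 < \<delta>" "\<And>x y. x \<in> S \<Longrightarrow> y \<in> S \<Longrightarrow> dist x y < \<delta> \<Longrightarrow> \<bar>f x - f y\<bar> < \<epsilon> / 2"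
    using compact_uniformly_continuous[OF cont \<open>compact S\<close>] \<open>0 < \<epsilon>\<close>
    by (auto elim!: uniformly_continuous_onE[of S f "\<epsilon> / 2"] simp: dist_real_def dist_commute)
  obtain M where M: "0 < M" "\<And>x. x \<in> S \<Longrightarrow> \<bar>f x\<bar> \<le> M"
    using compact_imp_bounded[OF compact_continuous_image[OF cont \<open>compact S\<close>]]
    unfolding bounded_pos by auto
  \<comment> \<open>With this slope the penalty at distance \<open>\<delta>\<close> is already
    \<open>2 * M\<close>, the largest possible oscillation of \<open>f\<close> on \<open>S\<close>;
    far points of the net therefore cannot pull the minimum below \<open>f x\<close>.\<close>
  define K where "K = 2 * M / \<delta>"
  have K: "0 < K" using M \<delta> by (simp add: K_def)
  \<comment> \<open>The net is fine enough that its point near \<open>x\<close> costs at most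
    \<open>\<epsilon> / 2\<close> in penalty and, by uniform continuity, less than
    \<open>\<epsilon> / 2\<close> in the value of \<open>f\<close>.\<close>
  define \<eta> where "\<eta> = min \<delta> (\<epsilon> / (2 * CARD('d) * K))"
  have \<eta>: "0 < \<eta>" using K \<delta> \<open>0 < \<epsilon>\<close> by (simp add: \<eta>_def)
  obtain T where T: "finite T" "T \<subseteq> S" "S \<subseteq> (\<Union>y\<in>T. ball y \<eta>)"
  proof (rule compactE_image[OF \<open>compact S\<close>, of S "\<lambda>y. ball y \<eta>"])
    show "S \<subseteq> (\<Union>y\<in>S. ball y \<eta>)" using \<eta> by force
  qed auto
  have "T \<noteq> {}" using T(3) \<open>S \<noteq> {}\<close> by auto
  define g where "g x = Min ((\<lambda>y. f y + K * D x y) ` T)" for x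
  have "relu_computable g"
    unfolding g_def D_def
    by (intro relu_computable_Min T \<open>T \<noteq> {}\<close> relu_computable_l1_dist)
  moreover have "\<bar>g x - f x\<bar> \<le> \<epsilon>" if x: "x \<in> S" for x
  proof -
    obtain y where y: "y \<in> T" "dist x y < \<eta>" using T(3) x by (auto simp: dist_commute)
    have "K * D x y \<le> K * (CARD('d) * \<eta>)"
      using D2[of x y] y(2) K by (intro mult_left_mono order_trans[OF D2]) auto
    also have "\<dots> \<le> K * (CARD('d) * (\<epsilon> / (2 * CARD('d) * K)))"
      using K by (intro mult_left_mono) (auto simp: \<eta>_def)
    also have "\<dots> = \<epsilon> / 2" using K by (simp add: field_simps)
    finally have "K * D x y \<le> \<epsilon> / 2" .
    moreover have "\<bar>f x - f y\<bar> < \<epsilon> / 2"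
      using \<delta>(2)[of x y] y T(2) x by (auto simp: \<eta>_def)
    ultimately have "f y + K * D x y \<le> f x + \<epsilon>" by linarith
    moreover have "g x \<le> f y + K * D x y"
      unfolding g_def using T(1) y(1) by (intro Min_le) auto
    moreover have "f x - \<epsilon> \<le> g x"
      unfolding g_def
    proof (rule Min.boundedI)
      fix v assume "v \<in> (\<lambda>y. f y + K * D x y) ` T"
      then obtain z where z: "z \<in> T" "v = f z + K * D x z" by auto
      have zS: "z \<in> S" using z T by auto
      have D0: "0 \<le> K * D x z" using K by (simp add: D_def sum_nonneg)
      show "f x - \<epsilon> \<le> v"
      \<comment> \<open>Near points are handled by uniform continuity, far points by the
        penalty.\<close>
      proof (cases "dist x z < \<delta>")
        case True
        then show ?thesis using \<delta>(2)[OF x zS] D0 \<open>0 < \<epsilon>\<close> unfolding z(2) by linarith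
      next
        case False
        then have "K * \<delta> \<le> K * D x z" using D1[of x z] K by (intro mult_left_mono) auto
        then have "2 * M \<le> K * D x z" using \<delta>(1) by (simp add: K_def)
        then show ?thesis using M(2)[OF x] M(2)[OF zS] \<open>0 < \<epsilon>\<close> unfolding z(2) by linarith
      qed
    qed (use T \<open>T \<noteq> {}\<close> in auto)
    ultimately show ?thesis by linarith
  qed
  ultimately show ?thesis by blast
qed

section \<open>Supremum norm, and approximation within the bound \<open>B\<close>\<close>

lemma unit_cube_nonempty: "(unit_cube :: (real ^ 'd::finite) set) \<noteq> {}"
  by (simp add: interval_eq_empty_cart not_less)

lemma supnorm_le:
  fixes g :: "real ^ 'd::finite \<Rightarrow> real"
  assumes "\<And>x. x \<in> unit_cube \<Longrightarrow> \<bar>g x\<bar> \<le> c"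
  shows "supnorm g \<le> c"
  unfolding supnorm_def using unit_cube_nonempty assms by (rule cSUP_least)

text \<open>A real-valued \<open>SUP\<close> dominates its family only if that family is bounded
  above; continuity on the compact cube ensures this.\<close>

lemma abs_le_supnorm:
  fixes g :: "real ^ 'd::finite \<Rightarrow> real"
  assumes "continuous_on unit_cube g" "x \<in> unit_cube"
  shows "\<bar>g x\<bar> \<le> supnorm g"
proof -
  have "bounded ((\<lambda>x. \<bar>g x\<bar>) ` unit_cube)"
    using assms(1) by (intro compact_imp_bounded compact_continuous_image continuous_on_rabs) auto
  then show ?thesis
    unfolding supnorm_def using assms(2) by (intro cSUP_upper bounded_imp_bdd_above)
qed

text \<open>A direct approximant of \<open>f\<close> could exceed the bound \<open>B\<close>.
  Shrinking \<open>f\<close> to \<open>(1 - t) * f\<close> leaves a margin \<open>t * B\<close>,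
  which the approximation error may fill. Shrinking and approximating each cost at most
  \<open>t * B\<close>, and \<open>t\<close> is chosen so that together they cost at most
  \<open>\<epsilon>\<close>.\<close>

lemma net_class_dense:
  fixes f :: "real ^ 'd::finite \<Rightarrow> real"
  assumes cont: "continuous_on unit_cube f" and "0 < B" "supnorm f \<le> B" "0 < \<epsilon>"
  shows "\<exists>L W g. CARD('d) \<le> W \<and> 1 \<le> L \<and> g \<in> net_class B L W \<and> (\<forall>x\<in>unit_cube. \<bar>g x - f x\<bar> \<le> \<epsilon>)"
proof -
  define t where "t = min 1 (\<epsilon> / (2 * B))"
  have t: "0 < t" "t \<le> 1" "2 * (t * B) \<le> \<epsilon>" using assms by (auto simp: t_def min_def field_simps)
  have "continuous_on unit_cube (\<lambda>x. (1 - t) * f x)" using cont by (intro continuous_intros)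
  then obtain g where g: "relu_computable g" "\<And>x. x \<in> unit_cube \<Longrightarrow> \<bar>g x - (1 - t) * f x\<bar> \<le> t * B"
    using relu_computable_dense[of unit_cube "\<lambda>x. (1 - t) * f x" "t * B"] t assms unit_cube_nonempty
    by (metis compact_cbox mult_pos_pos)
  have fB: "\<bar>f x\<bar> \<le> B" if "x \<in> unit_cube" for x
    using abs_le_supnorm[OF cont that] assms by linarith
  have "\<bar>g x\<bar> \<le> B" if x: "x \<in> unit_cube" for x
  proof -
    have "\<bar>(1 - t) * f x\<bar> \<le> (1 - t) * B" using fB[OF x] t by (simp add: abs_mult mult_left_mono)
    then show ?thesis using g(2)[OF x] by (simp add: algebra_simps)
  qed
  then have "supnorm g \<le> B" by (rule supnorm_le)
  moreover obtain n h where "relu_program n h" "affine_in n h g"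
    using g(1) relu_program.inputs unfolding relu_computable_def by meson
  moreover have "\<bar>g x - f x\<bar> \<le> \<epsilon>" if x: "x \<in> unit_cube" for x
  proof -
    have "\<bar>t * f x\<bar> \<le> t * B" using fB[OF x] t by (simp add: abs_mult mult_left_mono)
    then show ?thesis using g(2)[OF x] t(3) by (simp add: algebra_simps)
  qed
  ultimately show ?thesis using relu_program_net_class by meson
qed

text \<open>Induction over the layers, entry by entry. It makes \<open>abs_le_supnorm\<close> and
  the risk bounds applicable to the estimator on every path.\<close>

lemma net_class_continuous:
  assumes "f \<in> net_class B L W"
  shows "continuous_on unit_cube (f :: real ^ 'd::finite \<Rightarrow> real)"
proof -
  obtain w A b where w: "1 \<le> L" "w 1 = CARD('d)" "w (L + 1) = 1"
    and Ab: "\<forall>l\<in>{1..L}. A l \<in> carrier_mat (w (l + 1)) (w l) \<and> b l \<in> carrier_vec (w (l + 1))"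
    and f: "\<And>x. x \<in> unit_cube \<Longrightarrow> f x = vec_index (relu_net L A b (input_vec x)) 0"
    using assms unfolding net_class_def by blast
  let ?H = "\<lambda>l x. hidden_layers A b l (input_vec (x :: real ^ 'd))"
  have affine: "continuous_on unit_cube (\<lambda>x. vec_index (A (Suc l) *\<^sub>v ?H l x + b (Suc l)) i)"
    if "l < L" "\<And>x. dim_vec (?H l x) = w (Suc l)"
      "\<And>j. j < w (Suc l) \<Longrightarrow> continuous_on unit_cube (\<lambda>x. vec_index (?H l x) j)" "i < w (Suc (Suc l))"
    for l i
  proof -
    have "A (Suc l) \<in> carrier_mat (w (Suc (Suc l))) (w (Suc l))" "b (Suc l) \<in> carrier_vec (w (Suc (Suc l)))"
      using Ab that(1) by auto
    then show ?thesis
      using that by (auto simp: scalar_prod_def intro!: continuous_intros)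
  qed
  \<comment> \<open>The dimension belongs to the induction hypothesis because it fixes the range of
    the sum in the next matrix product.\<close>
  have hidden: "(\<forall>x. dim_vec (?H l x) = w (Suc l)) \<and>
      (\<forall>i<w (Suc l). continuous_on unit_cube (\<lambda>x. vec_index (?H l x) i))" if "l < L" for l
    using that
  proof (induction l)
    case 0
    then show ?case using w(2) by (auto simp: input_vec_def intro!: continuous_intros)
  next
    case (Suc l)
    have dims: "A (Suc l) \<in> carrier_mat (w (Suc (Suc l))) (w (Suc l))" "b (Suc l) \<in> carrier_vec (w (Suc (Suc l)))"
      using Ab Suc.prems by auto
    have "continuous_on unit_cube (\<lambda>x. vec_index (?H (Suc l) x) i)" if i: "i < w (Suc (Suc l))" for i
    proof -
      have "continuous_on unit_cube (\<lambda>x. max (vec_index (A (Suc l) *\<^sub>v ?H l x + b (Suc l)) i) 0)"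
        using affine[of l i] Suc i by (intro continuous_intros) auto
      then show ?thesis using dims i by (simp add: relu_def)
    qed
    then show ?case using dims by auto
  qed
  obtain l where L: "L = Suc l" using w(1) by (cases L) auto
  have "continuous_on unit_cube (\<lambda>x :: real ^ 'd. vec_index (relu_net L A b (input_vec x)) 0)"
    using affine[of l 0] hidden[of l] w(3) by (simp add: relu_net_def L)
  then show ?thesis using f by (simp cong: continuous_on_cong)
qed

section \<open>Adversarial risk and supremum norm\<close>

text \<open>For finite \<open>p\<close> the exact factor is the \<open>p\<close>-th root of
  \<open>CARD('d)\<close>, for infinite \<open>p\<close> it is 1; the cruder factor
  \<open>CARD('d)\<close> serves all orders at once.\<close>

lemma lp_norm_le:
  fixes z :: "real ^ 'd::finite" and t :: real
  assumes "1 \<le> p" "\<And>i. \<bar>vec_nth z i\<bar> \<le> t"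
  shows "lp_norm p z \<le> CARD('d) * t"
proof -
  have t: "0 \<le> t" using assms(2)[of undefined] by linarith
  have card: "1 \<le> real CARD('d)" by (simp add: Suc_le_eq)
  show ?thesis
  proof (cases "p = \<infinity>")
    case True
    have "infnorm z \<le> t"
      unfolding infnorm_cart using assms(2) by (intro cSup_least) auto
    also have "t \<le> CARD('d) * t" using card t mult_right_mono[of 1 "CARD('d)" t] by simp
    finally show ?thesis using True by (simp add: lp_norm_def)
  next
    case False
    then obtain q where p: "p = ereal q" and q: "1 \<le> q" using assms(1) by (cases p) auto
    have "(\<Sum>i\<in>UNIV. \<bar>vec_nth z i\<bar> powr q) \<le> CARD('d) * t powr q"
      using sum_bounded_above[of UNIV "\<lambda>i. \<bar>vec_nth z i\<bar> powr q" "t powr q"] assms(2) q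
      by (simp add: powr_mono2)
    then have "(\<Sum>i\<in>UNIV. \<bar>vec_nth z i\<bar> powr q) powr (1 / q) \<le> (CARD('d) * t powr q) powr (1 / q)"
      using q by (intro powr_mono2) (auto intro: sum_nonneg)
    also have "\<dots> = CARD('d) powr (1 / q) * t" using q t by (simp add: powr_mult powr_powr)
    also have "\<dots> \<le> CARD('d) powr 1 * t" using card q t by (intro mult_right_mono powr_mono) auto
    finally show ?thesis using p card by (simp add: lp_norm_def)
  qed
qed

text \<open>Each coordinate is bounded by the Euclidean norm. Whatever the order \<open>p\<close>,
  this reduces membership to a Euclidean distance, so that one cover by Euclidean balls
  suffices.\<close>

lemma adv_nbhd_memI:
  fixes x :: "real ^ 'd::finite"
  assumes "1 \<le> p" "x' \<in> unit_cube" "dist x x' \<le> h / CARD('d)"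
  shows "x' \<in> adv_nbhd p h x"
proof -
  have "\<bar>vec_nth (x - x') i\<bar> \<le> h / CARD('d)" for i
    using component_le_norm_cart[of "x - x'" i] assms(3) by (simp add: dist_norm)
  from lp_norm_le[OF assms(1) this] show ?thesis using assms(2) by (simp add: adv_nbhd_def)
qed

lemma adv_nbhd_self:
  fixes x :: "real ^ 'd::finite"
  assumes "1 \<le> p" "0 \<le> h" "x \<in> unit_cube"
  shows "x \<in> adv_nbhd p h x"
  by (rule adv_nbhd_memI) (use assms in simp_all)

lemma sq_le_SUP_adv_nbhd:
  fixes y f :: "real ^ 'd::finite \<Rightarrow> real"
  assumes "continuous_on unit_cube y" "continuous_on unit_cube f" "x \<in> adv_nbhd p h z"
  shows "(y x - f x)\<^sup>2 \<le> (SUP x'\<in>adv_nbhd p h z. (y x' - f x')\<^sup>2)"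
proof (rule cSUP_upper[OF assms(3)])
  have "bounded ((\<lambda>x. (y x - f x)\<^sup>2) ` unit_cube)"
    using assms by (intro compact_imp_bounded compact_continuous_image continuous_intros) auto
  then show "bdd_above ((\<lambda>x. (y x - f x)\<^sup>2) ` adv_nbhd p h z)"
    by (rule bdd_above_mono[OF bounded_imp_bdd_above]) (auto simp: adv_nbhd_def)
qed

text \<open>Here the adversarial supremum turns an empirical risk into a pointwise bound: each
  sample point whose neighbourhood contains \<open>u\<close> contributes at least the squared error
  at \<open>u\<close>. The other summands are nonnegative, as every neighbourhood contains its
  centre.\<close>

lemma card_mult_sq_le_adv_risk:
  fixes x :: "nat \<Rightarrow> real ^ 'd::finite" and y f :: "real ^ 'd \<Rightarrow> real"
  assumes "1 \<le> p" "0 \<le> h" and cont: "continuous_on unit_cube y" "continuous_on unit_cube f"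
    and "1 \<le> n" and x: "\<And>i. i < n \<Longrightarrow> x i \<in> unit_cube"
    and I: "I \<subseteq> {..<n}" "\<And>i. i \<in> I \<Longrightarrow> u \<in> adv_nbhd p h (x i)"
  shows "card I * (y u - f u)\<^sup>2 \<le> n * adv_risk p h n x y f"
proof -
  let ?S = "\<lambda>i. SUP x'\<in>adv_nbhd p h (x i). (y x' - f x')\<^sup>2"
  have "card I * (y u - f u)\<^sup>2 = (\<Sum>i\<in>I. (y u - f u)\<^sup>2)" by simp
  also have "\<dots> \<le> sum ?S I" by (intro sum_mono sq_le_SUP_adv_nbhd cont I(2))
  also have "\<dots> \<le> sum ?S {..<n}"
  proof (intro sum_mono2 I(1))
    fix i assume "i \<in> {..<n} - I"
    then have "x i \<in> adv_nbhd p h (x i)" using assms(1,2) x by (intro adv_nbhd_self) simp_all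
    from sq_le_SUP_adv_nbhd[OF cont this] show "0 \<le> ?S i" by (rule order_trans[OF zero_le_power2])
  qed simp
  also have "\<dots> = n * adv_risk p h n x y f" using \<open>1 \<le> n\<close> by (simp add: adv_risk_def)
  finally show ?thesis .
qed

text \<open>The opposite direction, for the competitor: a uniform error bound passes to each
  supremum and then to the average.\<close>

lemma adv_risk_le:
  fixes x :: "nat \<Rightarrow> real ^ 'd::finite" and y f :: "real ^ 'd \<Rightarrow> real"
  assumes "1 \<le> p" "0 \<le> h" "1 \<le> n" "\<And>i. i < n \<Longrightarrow> x i \<in> unit_cube"
    and e: "\<And>u. u \<in> unit_cube \<Longrightarrow> \<bar>y u - f u\<bar> \<le> e"
  shows "adv_risk p h n x y f \<le> e\<^sup>2"
proof -
  have "(\<Sum>i<n. SUP x'\<in>adv_nbhd p h (x i). (y x' - f x')\<^sup>2) \<le> (\<Sum>i<n. e\<^sup>2)"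
  proof (intro sum_mono cSUP_least)
    fix i assume "i \<in> {..<n}"
    then have "x i \<in> adv_nbhd p h (x i)" using assms(1,2,4) by (intro adv_nbhd_self) simp_all
    then show "adv_nbhd p h (x i) \<noteq> {}" by blast
  next
    fix i x' assume "x' \<in> adv_nbhd p h (x i)"
    then have "\<bar>y x' - f x'\<bar> \<le> e" using e by (simp add: adv_nbhd_def)
    then show "(y x' - f x')\<^sup>2 \<le> e\<^sup>2" using power_mono[of "\<bar>y x' - f x'\<bar>" e 2] by simp
  qed
  then show ?thesis using \<open>1 \<le> n\<close> by (simp add: adv_risk_def field_simps)
qed

lemma supnorm_nonneg:
  assumes "continuous_on unit_cube (g :: real ^ 'd::finite \<Rightarrow> real)"
  shows "0 \<le> supnorm g"
proof -
  obtain x :: "real ^ 'd" where "x \<in> unit_cube" using unit_cube_nonempty by blast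
  from abs_le_supnorm[OF assms this] show ?thesis by (rule order_trans[OF abs_ge_zero])
qed

lemma supnorm_sq_le:
  fixes g :: "real ^ 'd::finite \<Rightarrow> real"
  assumes "continuous_on unit_cube g" "\<And>x. x \<in> unit_cube \<Longrightarrow> (g x)\<^sup>2 \<le> R"
  shows "(supnorm g)\<^sup>2 \<le> R"
proof -
  obtain x :: "real ^ 'd" where "x \<in> unit_cube" using unit_cube_nonempty by blast
  then have R: "0 \<le> R" using assms(2)[of x] order_trans[OF zero_le_power2] by blast
  have "supnorm g \<le> sqrt R" using assms(2) by (intro supnorm_le) (simp add: real_le_rsqrt)
  then have "(supnorm g)\<^sup>2 \<le> (sqrt R)\<^sup>2" using supnorm_nonneg[OF assms(1)] by (intro power_mono)
  then show ?thesis using R by simp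
qed

text \<open>The deterministic core, for a fixed sample. By \<open>visits\<close>,
  \<open>q / 2\<close> times the squared error of \<open>f\<close> against \<open>y\<close> at any
  point is at most the risk of \<open>f\<close>, hence that of \<open>g\<close>, hence
  \<open>(S + e)\<^sup>2\<close>. Passing from \<open>y\<close> to \<open>fs\<close> doubles the
  resulting \<open>4 / q\<close> and adds the summand 2.\<close>

lemma supnorm_error_le:
  fixes x :: "nat \<Rightarrow> real ^ 'd::finite" and y f g fs :: "real ^ 'd \<Rightarrow> real"
  assumes ph: "1 \<le> p" "0 \<le> h" and q: "0 < q" and n: "1 \<le> n"
    and x: "\<And>i. i < n \<Longrightarrow> x i \<in> unit_cube"
    and cont: "continuous_on unit_cube y" "continuous_on unit_cube f" "continuous_on unit_cube fs"
    and risk: "adv_risk p h n x y f \<le> adv_risk p h n x y g"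
    and g: "\<And>u. u \<in> unit_cube \<Longrightarrow> \<bar>g u - fs u\<bar> \<le> e"
    and visits: "\<And>u. u \<in> unit_cube \<Longrightarrow> n * q / 2 \<le> card {i\<in>{..<n}. u \<in> adv_nbhd p h (x i)}"
  shows "(supnorm (\<lambda>u. f u - fs u))\<^sup>2 \<le> (8 / q + 2) * ((supnorm (\<lambda>u. y u - fs u))\<^sup>2 + e\<^sup>2)"
proof (rule supnorm_sq_le)
  define S where "S = supnorm (\<lambda>u. y u - fs u)"
  have S: "\<bar>y u - fs u\<bar> \<le> S" if "u \<in> unit_cube" for u
    unfolding S_def using abs_le_supnorm[of "\<lambda>u. y u - fs u" u] cont that
    by (simp add: continuous_on_diff)
  have sq: "(a + b)\<^sup>2 \<le> 2 * a\<^sup>2 + 2 * b\<^sup>2" for a b :: real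
    using zero_le_power2[of "a - b"] by (simp add: power2_eq_square algebra_simps)
  fix u :: "real ^ 'd" assume u: "u \<in> unit_cube"
  have "n * q / 2 * (y u - f u)\<^sup>2 \<le> card {i\<in>{..<n}. u \<in> adv_nbhd p h (x i)} * (y u - f u)\<^sup>2"
    using visits[OF u] by (intro mult_right_mono) auto
  also have "\<dots> \<le> n * adv_risk p h n x y f"
    using ph n x cont by (intro card_mult_sq_le_adv_risk) auto
  also have "\<dots> \<le> n * (S + e)\<^sup>2"
  proof (intro mult_left_mono order_trans[OF risk] adv_risk_le ph n x)
    fix v :: "real ^ 'd" assume "v \<in> unit_cube"
    then show "\<bar>y v - g v\<bar> \<le> S + e" using S[of v] g[of v] by linarith
  qed auto
  finally have "q * (y u - f u)\<^sup>2 \<le> 2 * (S + e)\<^sup>2" using n by (simp add: field_simps)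
  also have "\<dots> \<le> 4 * (S\<^sup>2 + e\<^sup>2)" using sq[of S e] by simp
  finally have D: "(y u - f u)\<^sup>2 \<le> 4 * (S\<^sup>2 + e\<^sup>2) / q" using q by (simp add: field_simps)
  have "(y u - fs u)\<^sup>2 \<le> S\<^sup>2" using power_mono[of "\<bar>y u - fs u\<bar>" S 2] S[OF u] by simp
  moreover have "(f u - fs u)\<^sup>2 \<le> 2 * (y u - f u)\<^sup>2 + 2 * (y u - fs u)\<^sup>2"
    using sq[of "f u - y u" "y u - fs u"] by (simp add: power2_commute)
  moreover have "0 \<le> e\<^sup>2" by simp
  ultimately have "(f u - fs u)\<^sup>2 \<le> 2 * (4 * (S\<^sup>2 + e\<^sup>2) / q) + 2 * (S\<^sup>2 + e\<^sup>2)"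
    using D by argo
  then show "(f u - fs u)\<^sup>2 \<le> (8 / q + 2) * ((supnorm (\<lambda>u. y u - fs u))\<^sup>2 + e\<^sup>2)"
    by (simp add: S_def[symmetric] algebra_simps add_divide_distrib)
qed (use cont in \<open>intro continuous_intros\<close>)

section \<open>Sample points in small balls\<close>

text \<open>The number of visits is a sum of independent indicators with mean at least
  \<open>n * q\<close>; Hoeffding's inequality bounds the chance of falling to half of that.\<close>

lemma (in prob_space) prob_few_visits_le:
  assumes indep: "indep_vars (\<lambda>_. borel) X UNIV" and A: "A \<in> sets borel"
    and q: "\<And>i. q \<le> prob (X i -` A \<inter> space M)" "0 \<le> q" and n: "1 \<le> (n::nat)"
  shows "prob {\<omega>\<in>space M. real (card {i\<in>{..<n}. X i \<omega> \<in> A}) \<le> n * q / 2} \<le> exp (- (n * q\<^sup>2 / 2))"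
proof -
  define Z where "Z i \<omega> = (indicator A (X i \<omega>) :: real)" for i \<omega>
  have X: "X i \<in> borel_measurable M" for i using indep unfolding indep_vars_def by auto
  have ZI: "indep_vars (\<lambda>_. borel) Z UNIV"
    unfolding Z_def using A by (intro indep_vars_compose2[OF indep]) auto
  interpret Hoeffding_ineq M "{..<n}" Z "\<lambda>_. 0" "\<lambda>_. 1" "\<Sum>i<n. expectation (Z i)"
    by unfold_locales (auto intro: indep_vars_subset[OF ZI] simp: Z_def indicator_def)
  have "expectation (Z i) = prob (X i -` A \<inter> space M)" for i
  proof -
    have "expectation (Z i) = expectation (indicator (X i -` A \<inter> space M))"
      by (intro Bochner_Integration.integral_cong) (auto simp: Z_def indicator_def)
    then show ?thesis using measurable_sets[OF X A] by simp
  qed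
  then have mu: "n * q \<le> (\<Sum>i<n. expectation (Z i))"
    using q(1) sum_bounded_below[of "{..<n}" q "\<lambda>i. expectation (Z i)"] by (simp add: mult.commute)
  \<comment> \<open>The deviation is measured from the true mean, so that the Hoeffding event has
    the threshold \<open>n * q / 2\<close> exactly.\<close>
  define \<epsilon> where "\<epsilon> = (\<Sum>i<n. expectation (Z i)) - n * q / 2"
  have eps: "n * q / 2 \<le> \<epsilon>" "0 \<le> n * q / 2" using mu q(2) by (auto simp: \<epsilon>_def mult.commute)
  have "(\<Sum>i<n. Z i \<omega>) = card {i\<in>{..<n}. X i \<omega> \<in> A}" for \<omega>
    unfolding Z_def by (simp add: indicator_def sum.If_cases Int_def)
  then have "prob {\<omega>\<in>space M. real (card {i\<in>{..<n}. X i \<omega> \<in> A}) \<le> n * q / 2} \<le> exp (- 2 * \<epsilon>\<^sup>2 / n)"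
    using Hoeffding_ineq_le[of \<epsilon>] eps n by (simp add: \<epsilon>_def field_simps)
  also have "(n * q / 2)\<^sup>2 \<le> \<epsilon>\<^sup>2" using eps by (intro power_mono)
  then have "exp (- 2 * \<epsilon>\<^sup>2 / n) \<le> exp (- 2 * (n * q / 2)\<^sup>2 / n)"
    using n by (simp add: divide_right_mono)
  also have "- 2 * (n * q / 2)\<^sup>2 / n = - (n * q\<^sup>2 / 2)"
    using n by (simp add: power2_eq_square field_simps)
  finally show ?thesis .
qed

text \<open>The centre may lie on the boundary. The cube is the closure of its interior, so the ball
  still meets the open cube, in a nonempty open and hence non-null set.\<close>

lemma emeasure_unit_cube_Int_ball_pos:
  fixes t :: "real ^ 'd::finite"
  assumes "t \<in> unit_cube" "0 < r"
  shows "0 < emeasure lborel (unit_cube \<inter> ball t r)"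
proof -
  have int: "box 0 1 \<noteq> ({} :: (real ^ 'd) set)" by (simp add: interval_eq_empty_cart)
  then have "t \<in> closure (box 0 1)" using assms(1) by (simp add: closure_box)
  then obtain y where "y \<in> box 0 1" "dist y t < r"
    using assms(2) unfolding closure_approachable by blast
  then have "y \<in> box 0 1 \<inter> ball t r" by (simp add: dist_commute)
  then have ne: "box 0 1 \<inter> ball t r \<noteq> {}" by blast
  then have "\<not> negligible (box 0 1 \<inter> ball t r)" by (intro open_not_negligible) auto
  then have "emeasure lborel (box 0 1 \<inter> ball t r) \<noteq> 0"
    by (simp add: negligible_iff_emeasure0 emeasure_completion)
  moreover have "emeasure lborel (box 0 1 \<inter> ball t r) \<le> emeasure lborel (unit_cube \<inter> ball t r)"
    using box_subset_cbox by (intro emeasure_mono) auto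
  ultimately show ?thesis by (simp add: zero_less_iff_neq_zero) (use le_zero_eq in force)
qed

text \<open>Two sets occur because the density is bounded below only on the cube: \<open>A\<close>
  will be a ball and \<open>S\<close> its part inside the cube.\<close>

lemma (in prob_space) prob_ge_density:
  assumes X: "distributed M lborel X (\<lambda>x. ennreal (f x))"
    and "\<And>x. x \<in> S \<Longrightarrow> C \<le> f x" and S: "S \<in> sets borel" "S \<subseteq> A" and A: "A \<in> sets borel"
  shows "ennreal C * emeasure lborel S \<le> ennreal (prob (X -` A \<inter> space M))"
proof -
  have "ennreal C * emeasure lborel S = (\<integral>\<^sup>+x. ennreal C * indicator S x \<partial>lborel)"
    using S by (simp add: nn_integral_cmult_indicator)
  also have "\<dots> \<le> (\<integral>\<^sup>+x. ennreal (f x) * indicator A x \<partial>lborel)"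
    using assms(2) S(2) by (intro nn_integral_mono) (auto simp: indicator_def intro: ennreal_leI)
  also have "\<dots> = emeasure M (X -` A \<inter> space M)"
    using distributed_emeasure[OF X, of A] A by simp
  finally show ?thesis by (simp add: emeasure_eq_measure)
qed

section \<open>Consistency\<close>

text \<open>By continuity the supremum may be taken over a countable dense subset of the
  cube.\<close>

lemma supnorm_measurable:
  fixes g :: "'w \<Rightarrow> real ^ 'd::finite \<Rightarrow> real"
  assumes "random_continuous_map M g"
  shows "(\<lambda>\<omega>. supnorm (g \<omega>)) \<in> borel_measurable M"
proof -
  obtain T :: "(real ^ 'd) set" where T: "countable T" "T \<subseteq> unit_cube" "unit_cube \<subseteq> closure T"
    using separable[of "unit_cube :: (real ^ 'd) set"] by blast
  have Tne: "T \<noteq> {}" using T(3) unit_cube_nonempty by fastforce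
  have cont: "continuous_on unit_cube (g \<omega>)" if "\<omega> \<in> space M" for \<omega>
    using assms that by (simp add: random_continuous_map_def)
  have bdd: "bdd_above ((\<lambda>x. \<bar>g \<omega> x\<bar>) ` T)" if "\<omega> \<in> space M" for \<omega>
    using abs_le_supnorm[OF cont[OF that]] T(2) by (intro bdd_aboveI2) auto
  have "supnorm (g \<omega>) = (SUP x\<in>T. \<bar>g \<omega> x\<bar>)" if \<omega>: "\<omega> \<in> space M" for \<omega>
  proof (rule antisym)
    show "supnorm (g \<omega>) \<le> (SUP x\<in>T. \<bar>g \<omega> x\<bar>)"
    proof (rule supnorm_le)
      fix x :: "real ^ 'd" assume x: "x \<in> unit_cube"
      have clo: "closure T = unit_cube" using T(2,3) by (intro subset_antisym closure_minimal) auto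
      show "\<bar>g \<omega> x\<bar> \<le> (SUP x\<in>T. \<bar>g \<omega> x\<bar>)"
      proof (rule continuous_le_on_closure[where S = T and f = "\<lambda>x. \<bar>g \<omega> x\<bar>"])
        show "continuous_on (closure T) (\<lambda>x. \<bar>g \<omega> x\<bar>)"
          unfolding clo using cont[OF \<omega>] by (intro continuous_intros)
        show "x \<in> closure T" using x clo by simp
        show "\<bar>g \<omega> y\<bar> \<le> (SUP x\<in>T. \<bar>g \<omega> x\<bar>)" if "y \<in> T" for y
          using bdd[OF \<omega>] that by (intro cSUP_upper)
      qed
    qed
    show "(SUP x\<in>T. \<bar>g \<omega> x\<bar>) \<le> supnorm (g \<omega>)"
      using Tne abs_le_supnorm[OF cont[OF \<omega>]] T(2) by (intro cSUP_least) auto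
  qed
  moreover have "(\<lambda>\<omega>. SUP x\<in>T. \<bar>g \<omega> x\<bar>) \<in> borel_measurable M"
    using assms T bdd by (intro borel_measurable_cSUP borel_measurable_abs) (auto simp: random_continuous_map_def)
  ultimately show ?thesis by (simp cong: measurable_cong)
qed

text \<open>Let \<open>\<kappa> n\<close> be the largest \<open>k \<le> n\<close> with
  \<open>(s k)\<^sup>2 \<le> n\<close>. Then \<open>s (\<kappa> n)\<close> is of order at most the
  square root of \<open>n\<close>, while every fixed \<open>k\<close> is eventually admissible, so
  \<open>\<kappa>\<close> tends to infinity.\<close>

lemma slow_reparametrization:
  fixes s :: "nat \<Rightarrow> nat"
  obtains \<kappa> where "filterlim \<kappa> at_top sequentially" "(\<lambda>n. real (s (\<kappa> n))) \<in> o(\<lambda>n. real n)"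
proof -
  \<comment> \<open>The index \<open>0\<close> is a default for those \<open>n\<close> at which no
    \<open>k\<close> qualifies; it accounts for the term \<open>(s 0)\<^sup>2\<close> below.\<close>
  define \<kappa> where "\<kappa> n = Max (insert 0 {k. k \<le> n \<and> (s k)\<^sup>2 \<le> n})" for n
  have fin: "finite (insert 0 {k. k \<le> n \<and> (s k)\<^sup>2 \<le> n})" for n by simp
  have "filterlim \<kappa> at_top sequentially"
    unfolding filterlim_at_top
  proof
    fix k
    show "\<forall>\<^sub>F n in sequentially. k \<le> \<kappa> n"
      using eventually_ge_at_top[of "max k ((s k)\<^sup>2)"]
      by eventually_elim (auto simp: \<kappa>_def intro!: Max_ge[OF fin])
  qed
  moreover have "(\<lambda>n. real (s (\<kappa> n))) \<in> o(\<lambda>n. real n)"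
  proof (rule landau_o.big_small_trans)
    show "(\<lambda>n. real (s (\<kappa> n))) \<in> O(\<lambda>n. sqrt (real n + (real (s 0))\<^sup>2))"
    proof (rule bigoI[of _ 1], rule always_eventually, rule allI)
      fix n
      have "\<kappa> n \<in> insert 0 {k. k \<le> n \<and> (s k)\<^sup>2 \<le> n}"
        unfolding \<kappa>_def by (rule Max_in[OF fin]) simp
      then have "(s (\<kappa> n))\<^sup>2 \<le> n + (s 0)\<^sup>2" by auto
      then have "(real (s (\<kappa> n)))\<^sup>2 \<le> real n + (real (s 0))\<^sup>2"
        by (metis of_nat_add of_nat_le_iff of_nat_power)
      then show "norm (real (s (\<kappa> n))) \<le> 1 * norm (sqrt (real n + (real (s 0))\<^sup>2))"
        by (simp add: real_le_rsqrt)
    qed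
    show "(\<lambda>n. sqrt (real n + (real (s 0))\<^sup>2)) \<in> o(\<lambda>n. real n)"
      by real_asymp
  qed
  ultimately show ?thesis by (rule that)
qed

theorem theorem2:
  fixes M :: "'w measure"
    and X :: "nat \<Rightarrow> 'w \<Rightarrow> real ^ 'd::finite"
    and Y \<xi> :: "nat \<Rightarrow> 'w \<Rightarrow> real"
    and fstar dens :: "real ^ 'd \<Rightarrow> real"
    and Yhat :: "nat \<Rightarrow> 'w \<Rightarrow> real ^ 'd \<Rightarrow> real"
    and p :: ereal
    and h hlow B C V :: real
    and \<zeta> :: "nat \<Rightarrow> real"
  assumes "prob_space M"
    and iid_indep: "prob_space.indep_vars M (\<lambda>_. borel) (\<lambda>i \<omega>. (X i \<omega>, Y i \<omega>)) UNIV"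
    and iid_ident: "\<And>i j. distr M borel (\<lambda>\<omega>. (X i \<omega>, Y i \<omega>)) = distr M borel (\<lambda>\<omega>. (X j \<omega>, Y j \<omega>))"
    and X_cube: "\<And>i \<omega>. \<omega> \<in> space M \<Longrightarrow> X i \<omega> \<in> unit_cube"
    and model: "\<And>i \<omega>. \<omega> \<in> space M \<Longrightarrow> Y i \<omega> = fstar (X i \<omega>) + \<xi> i \<omega>"
    and noise_indep: "\<And>i. indep_rv M borel (X i) borel (\<xi> i)"
    and noise_integrable: "\<And>i. integrable M (\<xi> i)"
    and noise_mean: "\<And>i. integral\<^sup>L M (\<xi> i) = 0"
    and noise_variance: "\<And>i. integrable M (\<lambda>\<omega>. (\<xi> i \<omega>)\<^sup>2)"
    and fstar_cont: "continuous_on unit_cube fstar"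
    and B: "1 \<le> B"
    and fstar_bound: "supnorm fstar \<le> B"
    and density: "\<And>i. distributed M lborel (X i) (\<lambda>x. ennreal (dens x))"
    and C: "0 < C"
    and density_lower: "\<And>x. x \<in> unit_cube \<Longrightarrow> C \<le> dens x"
    and p: "1 \<le> p"
    and h: "0 < hlow" "hlow < h" "h < 1"
    and Yhat_cont: "\<And>n. 1 \<le> n \<Longrightarrow> random_continuous_map M (Yhat n)"
    and V: "0 < V"
    and Yhat_bound: "\<And>n. 1 \<le> n \<Longrightarrow> expected_sq_supnorm M (Yhat n) \<le> ennreal (V\<^sup>2)"
    and \<zeta>_nonneg: "\<And>n. 0 \<le> \<zeta> n"
    and \<zeta>_lim: "\<zeta> \<longlonglongrightarrow> 0"
    and Yhat_consistent:
      "\<And>n. 1 \<le> n \<Longrightarrow> expected_sq_supnorm M (\<lambda>\<omega> x. Yhat n \<omega> x - fstar x) \<le> ennreal ((\<zeta> n)\<^sup>2)"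
  shows "\<exists>L W :: nat \<Rightarrow> nat.
      (\<lambda>n. real (L n * W n)) \<in> o(\<lambda>n. real n) \<and>
      (\<forall>n. 1 \<le> L n \<and> CARD('d) \<le> W n) \<and>
      (\<forall>fhat :: nat \<Rightarrow> 'w \<Rightarrow> real ^ 'd \<Rightarrow> real.
         (\<forall>n\<ge>1. adv_estimator M B p h (L n) (W n) n X (Yhat n) (fhat n)) \<longrightarrow>
         (\<lambda>n. expected_sq_supnorm M (\<lambda>\<omega> x. fhat n \<omega> x - fstar x)) \<longlonglongrightarrow> 0)"



proof -
  interpret prob_space M by fact
  have h0: "0 \<le> h" using h by linarith

  \<comment> \<open>Cover of the cube and lower bound for the probabilities of its balls\<close>
  define r where "r = h / (2 * CARD('d))"
  have r: "0 < r" using h by (simp add: r_def)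
  obtain T :: "(real ^ 'd) set" where T: "finite T" "T \<subseteq> unit_cube" "unit_cube \<subseteq> (\<Union>t\<in>T. ball t r)"
  proof (rule compactE_image[OF compact_cbox, of "unit_cube :: (real ^ 'd) set" "\<lambda>t. ball t r"])
    show "(unit_cube :: (real ^ 'd) set) \<subseteq> (\<Union>t\<in>unit_cube. ball t r)" using r by force
  qed auto

  \<comment> \<open>All \<open>X i\<close> have the same density, so \<open>C\<close> times the
    volume is a bound independent of \<open>i\<close>.\<close>
  have "\<exists>q>0. \<forall>i. q \<le> prob (X i -` ball t r \<inter> space M)" if t: "t \<in> T" for t
  proof -
    let ?S = "unit_cube \<inter> ball t r"
    have le: "ennreal C * emeasure lborel ?S \<le> ennreal (prob (X i -` ball t r \<inter> space M))" for i
      by (rule prob_ge_density[OF density]) (use density_lower in auto)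
    have "0 < emeasure lborel ?S" using emeasure_unit_cube_Int_ball_pos[of t r] T(2) t r by blast
    then have pos: "0 < ennreal C * emeasure lborel ?S" using C by (simp add: ennreal_zero_less_mult_iff)
    \<comment> \<open>Being dominated by a probability, the product is finite and can be turned into
      a real number.\<close>
    have fin: "ennreal C * emeasure lborel ?S < \<infinity>"
      using le[of 0] ennreal_less_top order_le_less_trans by (metis infinity_ennreal_def)
    define q where "q = enn2real (ennreal C * emeasure lborel ?S)"
    have q: "ennreal q = ennreal C * emeasure lborel ?S" using fin by (simp add: q_def)
    have "0 < q" using pos fin by (simp add: q_def enn2real_positive_iff)
    moreover have "q \<le> prob (X i -` ball t r \<inter> space M)" for i
      using le[of i] unfolding q[symmetric] by (simp add: ennreal_le_iff)
    ultimately show ?thesis by blast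
  qed
  then obtain q' where q': "\<And>t. t \<in> T \<Longrightarrow> 0 < q' t"
    "\<And>t i. t \<in> T \<Longrightarrow> q' t \<le> prob (X i -` ball t r \<inter> space M)" by metis
  \<comment> \<open>The inserted \<open>1\<close> keeps the minimum over a nonempty set of positive
    numbers.\<close>
  define q where "q = Min (insert 1 (q' ` T))"
  have q: "0 < q" using q'(1) T(1) by (auto simp: q_def)
  have qT: "q \<le> prob (X i -` ball t r \<inter> space M)" if "t \<in> T" for t i
  proof -
    have "q \<le> q' t" unfolding q_def using T(1) that by (intro Min_le) auto
    then show ?thesis using q'(2)[OF that, of i] by linarith
  qed
  have X_indep: "indep_vars (\<lambda>_. borel) X UNIV"
    using indep_vars_compose2[OF iid_indep, of "\<lambda>_. fst" "\<lambda>_. borel"]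
    by (simp add: borel_measurable_continuous_onI continuous_on_fst)
  have X_meas[measurable]: "X i \<in> borel_measurable M" for i
    using X_indep unfolding indep_vars_def by simp

  \<comment> \<open>The event that some ball is visited too rarely\<close>
  define few where "few n t = {\<omega>\<in>space M. real (card {i\<in>{..<n}. X i \<omega> \<in> ball t r}) \<le> n * q / 2}" for n :: nat and t
  \<comment> \<open>The union is finite and its index set does not depend on \<open>n\<close>, so
    the union bound still decays exponentially.\<close>
  define bad where "bad n = (\<Union>t\<in>T. few n t)" for n
  have few_meas: "few n t \<in> sets M" for n t
  proof -
    have "(\<lambda>\<omega>. \<Sum>i<n. indicator (ball t r) (X i \<omega>) :: real) \<in> borel_measurable M"
      by (intro borel_measurable_sum measurable_compose[OF X_meas borel_measurable_indicator]) auto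
    moreover have "(\<Sum>i<n. indicator (ball t r) (X i \<omega>)) = real (card {i\<in>{..<n}. X i \<omega> \<in> ball t r})" for \<omega>
      by (simp add: indicator_def sum.If_cases Int_def)
    ultimately show ?thesis unfolding few_def by simp
  qed
  then have bad_meas[measurable]: "bad n \<in> sets M" for n unfolding bad_def using T(1) by blast
  have bad_prob: "prob (bad n) \<le> card T * exp (- (n * q\<^sup>2 / 2))" if "1 \<le> n" for n
  proof -
    have "prob (bad n) \<le> (\<Sum>t\<in>T. prob (few n t))"
      unfolding bad_def using T(1) few_meas by (intro finite_measure_subadditive_finite) auto
    also have "\<dots> \<le> (\<Sum>t\<in>T. exp (- (n * q\<^sup>2 / 2)))"
      unfolding few_def using q qT that by (intro sum_mono prob_few_visits_le X_indep) auto
    finally show ?thesis by simp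
  qed

  \<comment> \<open>Competing networks and their sizes\<close>
  have "\<exists>L W g. CARD('d) \<le> W \<and> 1 \<le> L \<and> g \<in> net_class B L W \<and> (\<forall>x\<in>unit_cube. \<bar>g x - fstar x\<bar> \<le> 1 / real (Suc k))" for k
    using B by (intro net_class_dense fstar_cont fstar_bound) auto
  then obtain l w g where net: "\<And>k. CARD('d) \<le> w k" "\<And>k. 1 \<le> l k" "\<And>k. g k \<in> net_class B (l k) (w k)"
    "\<And>k x. x \<in> unit_cube \<Longrightarrow> \<bar>g k x - fstar x\<bar> \<le> 1 / real (Suc k)"
    by metis
  \<comment> \<open>Density gives no rate for the size \<open>l k * w k\<close>; the index
    \<open>\<kappa> n\<close> grows slowly enough to make it \<open>o(n)\<close>.\<close>
  obtain \<kappa> where \<kappa>: "filterlim \<kappa> at_top sequentially" "(\<lambda>n. real (l (\<kappa> n) * w (\<kappa> n))) \<in> o(\<lambda>n. real n)"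
    using slow_reparametrization[of "\<lambda>k. l k * w k"] by blast
  define e where "e n = 1 / real (Suc (\<kappa> n))" for n
  have e: "e \<longlonglongrightarrow> 0"
    unfolding e_def using filterlim_compose[OF LIMSEQ_inverse_real_of_nat \<kappa>(1)] by (simp add: inverse_eq_divide)

  \<comment> \<open>The error bound and its limit\<close>
  define K where "K = 8 / q + 2"
  have K: "0 \<le> K" using q by (simp add: K_def)
  \<comment> \<open>The three terms stem from the preprocessing, from the approximation by networks
    and from the bad event, where the squared error is at most
    \<open>(2 * B)\<^sup>2\<close>.\<close>
  define bound where "bound n = K * (\<zeta> n)\<^sup>2 + K * (e n)\<^sup>2 + 4 * B\<^sup>2 * (card T * exp (- (real n * q\<^sup>2 / 2)))" for n
  have "(\<lambda>n. exp (- (real n * q\<^sup>2 / 2))) \<longlonglongrightarrow> (0 :: real)" using q by real_asymp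
  then have "bound \<longlonglongrightarrow> K * 0\<^sup>2 + K * 0\<^sup>2 + 4 * B\<^sup>2 * (real (card T) * 0)"
    unfolding bound_def by (intro tendsto_intros \<zeta>_lim e)
  then have bound0: "(\<lambda>n. ennreal (bound n)) \<longlonglongrightarrow> 0" using tendsto_ennrealI by fastforce

  have "(\<lambda>n. expected_sq_supnorm M (\<lambda>\<omega> x. fhat n \<omega> x - fstar x)) \<longlonglongrightarrow> 0"
    if est: "\<forall>n\<ge>1. adv_estimator M B p h (l (\<kappa> n)) (w (\<kappa> n)) n X (Yhat n) (fhat n)" for fhat
  proof (rule tendsto_sandwich[OF _ _ tendsto_const bound0])
    show "\<forall>\<^sub>F n in sequentially. expected_sq_supnorm M (\<lambda>\<omega> x. fhat n \<omega> x - fstar x) \<le> ennreal (bound n)"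
      using eventually_ge_at_top[of 1]
    proof eventually_elim
      case (elim n)
      let ?S = "\<lambda>\<omega>. supnorm (\<lambda>x. Yhat n \<omega> x - fstar x)"
      have Ycont: "continuous_on unit_cube (Yhat n \<omega>)" if "\<omega> \<in> space M" for \<omega>
        using Yhat_cont[OF elim] that by (simp add: random_continuous_map_def)
      have "random_continuous_map M (\<lambda>\<omega> x. Yhat n \<omega> x - fstar x)"
        using Yhat_cont[OF elim] fstar_cont
        by (auto simp: random_continuous_map_def intro!: continuous_intros)
      from supnorm_measurable[OF this] have [measurable]: "?S \<in> borel_measurable M" .
      \<comment> \<open>The indicator merges the two cases into one pathwise inequality that can be
        integrated.\<close>
      have path: "(supnorm (\<lambda>x. fhat n \<omega> x - fstar x))\<^sup>2
          \<le> K * (?S \<omega>)\<^sup>2 + K * (e n)\<^sup>2 + 4 * B\<^sup>2 * indicator (bad n) \<omega>" if \<omega>: "\<omega> \<in> space M" for \<omega>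
      proof -
        have min: "is_arg_min (adv_risk p h n (\<lambda>i. X i \<omega>) (Yhat n \<omega>))
            (\<lambda>f. f \<in> net_class B (l (\<kappa> n)) (w (\<kappa> n))) (fhat n \<omega>)"
          using est elim \<omega> by (simp add: adv_estimator_def)
        then have f: "fhat n \<omega> \<in> net_class B (l (\<kappa> n)) (w (\<kappa> n))" by (simp add: is_arg_min_def)
        note fcont = net_class_continuous[OF f]
        show ?thesis
        proof (cases "\<omega> \<in> bad n")
          case True
          have "(supnorm (\<lambda>x. fhat n \<omega> x - fstar x))\<^sup>2 \<le> (2 * B)\<^sup>2"
          proof (rule supnorm_sq_le)
            fix x :: "real ^ 'd" assume x: "x \<in> unit_cube"
            have "supnorm (fhat n \<omega>) \<le> B" using f by (simp add: net_class_def)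
            then have "\<bar>fhat n \<omega> x - fstar x\<bar> \<le> 2 * B"
              using abs_le_supnorm[OF fcont x] abs_le_supnorm[OF fstar_cont x] fstar_bound by linarith
            then show "(fhat n \<omega> x - fstar x)\<^sup>2 \<le> (2 * B)\<^sup>2"
              using power_mono[of "\<bar>fhat n \<omega> x - fstar x\<bar>" "2 * B" 2] by simp
          qed (intro continuous_intros fcont fstar_cont)
          moreover have "0 \<le> K * (?S \<omega>)\<^sup>2" "0 \<le> K * (e n)\<^sup>2" using K by simp_all
          ultimately show ?thesis using True by (simp add: power_mult_distrib)
        next
          case False
          have "(supnorm (\<lambda>x. fhat n \<omega> x - fstar x))\<^sup>2 \<le> (8 / q + 2) * ((?S \<omega>)\<^sup>2 + (e n)\<^sup>2)"
          proof (rule supnorm_error_le[where g = "g (\<kappa> n)" and x = "\<lambda>i. X i \<omega>"])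
            \<comment> \<open>The network \<open>g (\<kappa> n)\<close> lies in the very class over
              which \<open>fhat n \<omega>\<close> minimises.\<close>
            show "adv_risk p h n (\<lambda>i. X i \<omega>) (Yhat n \<omega>) (fhat n \<omega>) \<le> adv_risk p h n (\<lambda>i. X i \<omega>) (Yhat n \<omega>) (g (\<kappa> n))"
              using min net(3)[of "\<kappa> n"] by (auto simp: is_arg_min_def not_less)
            show "\<bar>g (\<kappa> n) u - fstar u\<bar> \<le> e n" if "u \<in> unit_cube" for u
              unfolding e_def using net(4)[OF that] .
            show "n * q / 2 \<le> card {i\<in>{..<n}. u \<in> adv_nbhd p h (X i \<omega>)}" if u: "u \<in> unit_cube" for u
            proof -
              \<comment> \<open>The point \<open>u\<close> shares the ball around \<open>t\<close>
                with more than \<open>n * q / 2\<close> sample points, each within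
                \<open>2 * r = h / CARD('d)\<close> of \<open>u\<close>. Finitely many balls thus
                serve all \<open>u\<close> at once.\<close>
              obtain t where t: "t \<in> T" "dist t u < r" using T(3) u by auto
              then have "n * q / 2 < card {i\<in>{..<n}. X i \<omega> \<in> ball t r}"
                using False \<omega> by (auto simp: bad_def few_def not_le)
              also have "card {i\<in>{..<n}. X i \<omega> \<in> ball t r} \<le> card {i\<in>{..<n}. u \<in> adv_nbhd p h (X i \<omega>)}"
              proof (intro card_mono subsetI CollectI conjI)
                fix i assume i: "i \<in> {i\<in>{..<n}. X i \<omega> \<in> ball t r}"
                then have "dist (X i \<omega>) u \<le> r + r"
                  using t(2) dist_triangle[of "X i \<omega>" u t] by (simp add: dist_commute)
                also have "r + r = h / CARD('d)" by (simp add: r_def field_simps)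
                finally show "u \<in> adv_nbhd p h (X i \<omega>)" by (rule adv_nbhd_memI[OF p u])
              qed auto
              finally show ?thesis by simp
            qed
          qed (use p h0 q elim X_cube[OF \<omega>] Ycont[OF \<omega>] fcont fstar_cont in auto)
          then show ?thesis using False by (simp add: K_def algebra_simps)
        qed
      qed
      \<comment> \<open>The summands of the upper bound are measurable, \<open>?S\<close> by
        \<open>supnorm_measurable\<close>, so its integral splits into three known terms.\<close>
      have "expected_sq_supnorm M (\<lambda>\<omega> x. fhat n \<omega> x - fstar x)
          \<le> (\<integral>\<^sup>+\<omega>. ennreal K * ennreal ((?S \<omega>)\<^sup>2) + ennreal (K * (e n)\<^sup>2)
                + ennreal (4 * B\<^sup>2) * indicator (bad n) \<omega> \<partial>M)"
        unfolding expected_sq_supnorm_def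
      proof (rule nn_integral_mono)
        fix \<omega> assume \<omega>: "\<omega> \<in> space M"
        have "ennreal ((supnorm (\<lambda>x. fhat n \<omega> x - fstar x))\<^sup>2)
            \<le> ennreal (K * (?S \<omega>)\<^sup>2 + K * (e n)\<^sup>2 + 4 * B\<^sup>2 * indicator (bad n) \<omega>)"
          using path[OF \<omega>] by (rule ennreal_leI)
        also have "\<dots> = ennreal K * ennreal ((?S \<omega>)\<^sup>2) + ennreal (K * (e n)\<^sup>2)
              + ennreal (4 * B\<^sup>2) * indicator (bad n) \<omega>"
          using K by (simp add: ennreal_mult ennreal_plus indicator_def)
        finally show "ennreal ((supnorm (\<lambda>x. fhat n \<omega> x - fstar x))\<^sup>2)
            \<le> ennreal K * ennreal ((?S \<omega>)\<^sup>2) + ennreal (K * (e n)\<^sup>2)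
              + ennreal (4 * B\<^sup>2) * indicator (bad n) \<omega>" .
      qed
      also have "\<dots> = ennreal K * expected_sq_supnorm M (\<lambda>\<omega> x. Yhat n \<omega> x - fstar x)
          + ennreal (K * (e n)\<^sup>2) + ennreal (4 * B\<^sup>2) * ennreal (prob (bad n))"
        unfolding expected_sq_supnorm_def
        by (simp add: nn_integral_add nn_integral_cmult emeasure_eq_measure prob_space)
      also have "\<dots> \<le> ennreal K * ennreal ((\<zeta> n)\<^sup>2) + ennreal (K * (e n)\<^sup>2)
          + ennreal (4 * B\<^sup>2) * ennreal (card T * exp (- (n * q\<^sup>2 / 2)))"
        using Yhat_consistent[OF elim] bad_prob[OF elim] K
        by (intro add_mono mult_left_mono ennreal_leI) auto
      also have "\<dots> = ennreal (bound n)"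
        using K by (simp add: bound_def ennreal_mult ennreal_plus)
      finally show ?case .
    qed
  qed simp
  then show ?thesis
    using \<kappa>(2) net(1,2) by (intro exI[of _ "\<lambda>n. l (\<kappa> n)"] exI[of _ "\<lambda>n. w (\<kappa> n)"]) blast
qed

end
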